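(* Let $S$ be a semiring and let $M$ be an $S$-semimodule. Then $M$ is minimal if and only if there exists a regular right congruence $\mu$ on $S$ such that $S/\mu\simeq M$ (as $S$-semimodules) and $[0]_\mu$ is a maximal $\mu$-saturated right ideal in $S$.
   Context: A semiring $(S,+,\cdot)$ is a set with $(S,+)$ a commutative monoid with identity $0$, $(S,\cdot)$ a semigroup (no multiplicative identity is assumed), multiplication distributing over addition on both sides, and $0s=s0=0$ for all $s$. An $S$-semimodule is a right $S$-semimodule: a commutative monoid $(M,+,0_M)$ with a map $M\times S\to M$ such that $(m_1+m_2)s=m_1s+m_2s$, $m(s_1+s_2)=ms_1+ms_2$, $m(s_1s_2)=(ms_1)s_2$, $m0=0_M=0_Ms$. $M$ is called minimal if $MS\neq 0$ (i.e. $ms\ne 0_M$ for some $m\in M,s\in S$) and its only subsemimodules are $(0)$ and $M$. A right congruence on $S$ is an equivalence relation $\mu$ such that $(a,b)\in\mu$ implies $(a+c,b+c),(ac,bc)\in\mu$ for all $c\in S$; $[s]_\mu$ denotes the $\mu$-class of $s$. $S/\mu$ is a right $S$-semimodule via $[a]_\mu s=[as]_\mu$. A right congruence $\mu$ is regular if there exists $e\in S$ with $(es,s)\in\mu$ for every $s\in S$. A right ideal $I$ of $S$ is $\mu$-saturated if for all $s\in S$, $i\in I$, $(s,i)\in\mu$ implies $s\in I$. A maximal $\mu$-saturated right ideal is a proper $\mu$-saturated right ideal that is maximal under inclusion among proper $\mu$-saturated right ideals. *)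

theory Defs
  imports "HOL-Algebra.Ring"
begin

text \<open>
  The ambient semiring \<open>S\<close> is a type \<open>'s\<close> of class \<^class>\<open>semiring_0\<close>: it has no
  multiplicative identity and need not be commutative.

  Semimodules have explicit carriers, because the quotient \<open>S/\<mu>\<close> lives on a set of classes. As in
  the library's modules, the additive monoid is carried by the \<open>zero\<close> and \<open>add\<close> fields of the ring
  record, whose fields \<open>mult\<close> and \<open>one\<close> are irrelevant. The scalar acts from the right.
\<close>

record ('m, 's) semimodule = "'m ring" +
  act :: "'m \<Rightarrow> 's \<Rightarrow> 'm" (infixl "\<triangleleft>\<index>" 70)

locale right_semimodule = abelian_monoid M
  for M :: "('m, 's::semiring_0, 'more) semimodule_scheme" (structure) +
  assumes act_closed: "m \<in> carrier M \<Longrightarrow> m \<triangleleft> s \<in> carrier M"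
    and act_add_left: "m \<in> carrier M \<Longrightarrow> n \<in> carrier M \<Longrightarrow> (m \<oplus> n) \<triangleleft> s = (m \<triangleleft> s) \<oplus> (n \<triangleleft> s)"
    and act_add_right: "m \<in> carrier M \<Longrightarrow> m \<triangleleft> (s + t) = (m \<triangleleft> s) \<oplus> (m \<triangleleft> t)"
    and act_mult: "m \<in> carrier M \<Longrightarrow> m \<triangleleft> (s * t) = (m \<triangleleft> s) \<triangleleft> t"
    and act_zero_right: "m \<in> carrier M \<Longrightarrow> m \<triangleleft> 0 = \<zero>"
    and act_zero_left: "\<zero> \<triangleleft> s = \<zero>"

definition subsemimodule :: "'m set \<Rightarrow> ('m, 's::semiring_0, 'more) semimodule_scheme \<Rightarrow> bool" where
  "subsemimodule N M \<longleftrightarrow>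
     N \<subseteq> carrier M \<and> \<zero>\<^bsub>M\<^esub> \<in> N \<and>
     (\<forall>m\<in>N. \<forall>n\<in>N. m \<oplus>\<^bsub>M\<^esub> n \<in> N) \<and>
     (\<forall>m\<in>N. \<forall>s. m \<triangleleft>\<^bsub>M\<^esub> s \<in> N)"

definition minimal_semimodule :: "('m, 's::semiring_0, 'more) semimodule_scheme \<Rightarrow> bool" where
  "minimal_semimodule M \<longleftrightarrow>
     (\<exists>m\<in>carrier M. \<exists>s. m \<triangleleft>\<^bsub>M\<^esub> s \<noteq> \<zero>\<^bsub>M\<^esub>) \<and>
     (\<forall>N. subsemimodule N M \<longrightarrow> N = {\<zero>\<^bsub>M\<^esub>} \<or> N = carrier M)"

definition semimodule_hom ::
  "('m, 's::semiring_0, 'more1) semimodule_scheme \<Rightarrow> ('n, 's, 'more2) semimodule_scheme \<Rightarrow> ('m \<Rightarrow> 'n) set"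
where
  "semimodule_hom M N = {f. f \<in> carrier M \<rightarrow> carrier N \<and>
     f \<zero>\<^bsub>M\<^esub> = \<zero>\<^bsub>N\<^esub> \<and>
     (\<forall>m\<in>carrier M. \<forall>n\<in>carrier M. f (m \<oplus>\<^bsub>M\<^esub> n) = f m \<oplus>\<^bsub>N\<^esub> f n) \<and>
     (\<forall>m\<in>carrier M. \<forall>s. f (m \<triangleleft>\<^bsub>M\<^esub> s) = f m \<triangleleft>\<^bsub>N\<^esub> s)}"

definition semimodule_iso ::
  "('m, 's::semiring_0, 'more1) semimodule_scheme \<Rightarrow> ('n, 's, 'more2) semimodule_scheme \<Rightarrow> bool"
  (infix "\<simeq>\<^sub>S" 60)
where
  "M \<simeq>\<^sub>S N \<longleftrightarrow> (\<exists>f\<in>semimodule_hom M N. bij_betw f (carrier M) (carrier N))"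

definition right_congruence :: "('s::semiring_0 \<times> 's) set \<Rightarrow> bool" where
  "right_congruence \<mu> \<longleftrightarrow>
     equiv UNIV \<mu> \<and>
     (\<forall>a b c. (a, b) \<in> \<mu> \<longrightarrow> (a + c, b + c) \<in> \<mu> \<and> (a * c, b * c) \<in> \<mu>)"

definition regular_right_congruence :: "('s::semiring_0 \<times> 's) set \<Rightarrow> bool" where
  "regular_right_congruence \<mu> \<longleftrightarrow> right_congruence \<mu> \<and> (\<exists>e. \<forall>s. (e * s, s) \<in> \<mu>)"

text \<open>
  \<open>\<mu> `` {s}\<close> is the \<open>\<mu>\<close>-class of \<open>s\<close>. For a right congruence the unions below do not
  depend on representatives; see \<open>quotient_add\<close> and \<open>quotient_act\<close>.
\<close>

definition quotient_semimodule :: "('s::semiring_0 \<times> 's) set \<Rightarrow> ('s set, 's) semimodule" where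
  "quotient_semimodule \<mu> =
     \<lparr>carrier = UNIV // \<mu>, mult = undefined, one = undefined,
      zero = \<mu> `` {0},
      add = (\<lambda>X Y. \<Union>x\<in>X. \<Union>y\<in>Y. \<mu> `` {x + y}),
      act = (\<lambda>X s. \<Union>x\<in>X. \<mu> `` {x * s})\<rparr>"

definition right_ideal :: "'s::semiring_0 set \<Rightarrow> bool" where
  "right_ideal I \<longleftrightarrow>
     0 \<in> I \<and> (\<forall>a\<in>I. \<forall>b\<in>I. a + b \<in> I) \<and> (\<forall>a\<in>I. \<forall>s. a * s \<in> I)"

definition saturated_right_ideal :: "('s::semiring_0 \<times> 's) set \<Rightarrow> 's set \<Rightarrow> bool" where
  "saturated_right_ideal \<mu> I \<longleftrightarrow>
     right_ideal I \<and> (\<forall>s. \<forall>i\<in>I. (s, i) \<in> \<mu> \<longrightarrow> s \<in> I)"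

definition maximal_saturated_right_ideal :: "('s::semiring_0 \<times> 's) set \<Rightarrow> 's set \<Rightarrow> bool" where
  "maximal_saturated_right_ideal \<mu> I \<longleftrightarrow>
     saturated_right_ideal \<mu> I \<and> I \<noteq> UNIV \<and>
     (\<forall>J. saturated_right_ideal \<mu> J \<and> J \<noteq> UNIV \<and> I \<subseteq> J \<longrightarrow> J = I)"

lemma right_congruence_add:
  assumes "right_congruence \<mu>" "(a, b) \<in> \<mu>" "(c, d) \<in> \<mu>"
  shows "(a + c, b + d) \<in> \<mu>"
proof -
  have "trans \<mu>" using assms(1) by (simp add: right_congruence_def equiv_def)
  moreover have "(a + c, b + c) \<in> \<mu>" "(c + b, d + b) \<in> \<mu>"
    using assms by (auto simp: right_congruence_def)
  ultimately show ?thesis by (metis add.commute transD)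
qed

lemma quotient_add:
  assumes "right_congruence \<mu>"
  shows "\<mu> `` {a} \<oplus>\<^bsub>quotient_semimodule \<mu>\<^esub> \<mu> `` {b} = \<mu> `` {a + b}"
proof -
  have e: "equiv UNIV \<mu>" using assms by (simp add: right_congruence_def)
  have "\<mu> `` {x + y} = \<mu> `` {a + b}" if "(a, x) \<in> \<mu>" "(b, y) \<in> \<mu>" for x y
    using equiv_class_eq[OF e right_congruence_add[OF assms that]] by simp
  moreover have "(a, a) \<in> \<mu>" "(b, b) \<in> \<mu>"
    using e by (auto simp: equiv_def refl_on_def)
  ultimately have "(\<Union>x\<in>\<mu> `` {a}. \<Union>y\<in>\<mu> `` {b}. \<mu> `` {x + y}) = \<mu> `` {a + b}"
    by blast
  then show ?thesis by (simp add: quotient_semimodule_def)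
qed

lemma quotient_act:
  assumes "right_congruence \<mu>"
  shows "\<mu> `` {a} \<triangleleft>\<^bsub>quotient_semimodule \<mu>\<^esub> s = \<mu> `` {a * s}"
proof -
  have e: "equiv UNIV \<mu>" using assms by (simp add: right_congruence_def)
  have "\<mu> `` {x * s} = \<mu> `` {a * s}" if "(a, x) \<in> \<mu>" for x
  proof -
    have "(a * s, x * s) \<in> \<mu>" using assms that by (simp add: right_congruence_def)
    from equiv_class_eq[OF e this] show ?thesis by simp
  qed
  moreover have "(a, a) \<in> \<mu>" using e by (auto simp: equiv_def refl_on_def)
  ultimately have "(\<Union>x\<in>\<mu> `` {a}. \<mu> `` {x * s}) = \<mu> `` {a * s}"
    by blast
  then show ?thesis by (simp add: quotient_semimodule_def)
qed

lemma right_semimodule_quotient: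
  fixes \<mu> :: "('s::semiring_0 \<times> 's) set"
  assumes "right_congruence \<mu>"
  shows "right_semimodule (quotient_semimodule \<mu>)"
proof -
  define Q where "Q = quotient_semimodule \<mu>"
  define k where "k = (\<lambda>a. \<mu> `` {a})"
  have c: "x \<in> carrier Q \<longleftrightarrow> (\<exists>a. x = k a)" for x
    by (auto simp: Q_def k_def quotient_semimodule_def quotient_def)
  have z: "\<zero>\<^bsub>Q\<^esub> = k 0"
    by (simp add: Q_def k_def quotient_semimodule_def)
  have p: "k a \<oplus>\<^bsub>Q\<^esub> k b = k (a + b)" for a b
    unfolding Q_def k_def by (rule quotient_add[OF assms])
  have m: "k a \<triangleleft>\<^bsub>Q\<^esub> s = k (a * s)" for a s
    unfolding Q_def k_def by (rule quotient_act[OF assms])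
  have "abelian_monoid Q"
    by (rule abelian_monoidI) (auto simp: c z p add.assoc add.commute add.left_commute)
  then have "right_semimodule Q"
    by (auto simp: right_semimodule_def right_semimodule_axioms_def c z p m
        distrib_left distrib_right mult.assoc)
  then show ?thesis by (simp add: Q_def)
qed

end

theory Submission
  imports Defs
begin

text \<open>
  Giving \<open>S/\<mu> \<simeq> M\<close> amounts to giving a right-linear surjection \<open>g : S \<rightarrow> M\<close> whose kernel
  congruence is \<open>\<mu>\<close> (\<open>quotient_iso_iff_cover\<close>), so the theorem is about such covers. Taking
  preimages under \<open>g\<close> matches the subsemimodules of \<open>M\<close> with the \<open>\<mu>\<close>-saturated right ideals
  containing \<open>[0]\<^sub>\<mu>\<close>; hence \<open>[0]\<^sub>\<mu>\<close> is maximal exactly when \<open>M\<close> is nonzero and has only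
  the two trivial subsemimodules (\<open>maximal_kernel_class_iff\<close>).

  It remains to relate regularity of \<open>\<mu>\<close> to \<open>M S \<noteq> 0\<close>. If \<open>e\<close> is a left identity modulo \<open>\<mu>\<close>, then
  \<open>g e \<triangleleft> s = g s\<close> and \<open>g\<close> is not zero, so \<open>M S \<noteq> 0\<close>. Conversely, in a minimal \<open>M\<close> some element
  has \<open>m S \<noteq> 0\<close>, hence \<open>m S = M\<close> (\<open>minimal_cyclic\<close>), and \<open>s \<mapsto> m \<triangleleft> s\<close> is a cover. As \<open>m\<close> itself
  lies in \<open>m S\<close>, there is \<open>e\<close> with \<open>m \<triangleleft> e = m\<close>, and this \<open>e\<close> is a left identity modulo the kernel.
\<close>

definition linear_cover ::
  "('s::semiring_0 \<Rightarrow> 'm) \<Rightarrow> ('m, 's, 'more) semimodule_scheme \<Rightarrow> bool" where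
  "linear_cover g M \<longleftrightarrow>
     range g = carrier M \<and> g 0 = \<zero>\<^bsub>M\<^esub> \<and>
     (\<forall>a b. g (a + b) = g a \<oplus>\<^bsub>M\<^esub> g b) \<and>
     (\<forall>a s. g (a * s) = g a \<triangleleft>\<^bsub>M\<^esub> s)"

definition kernel_congruence :: "('s \<Rightarrow> 'm) \<Rightarrow> ('s \<times> 's) set" where
  "kernel_congruence g = {(a, b). g a = g b}"

lemma right_congruence_kernel:
  assumes "linear_cover g M"
  shows "right_congruence (kernel_congruence g)"
proof -
  have "equiv UNIV (kernel_congruence g)"
    by (rule equivI) (auto simp: kernel_congruence_def intro: refl_onI symI transI)
  then show ?thesis
    using assms by (simp add: right_congruence_def kernel_congruence_def linear_cover_def)
qed

text \<open>The homomorphism theorem for quotients of \<open>S\<close>: an isomorphism and a cover determine each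
  other by \<open>f [s]\<^sub>\<mu> = g s\<close>.\<close>

lemma quotient_iso_iff_cover:
  fixes \<mu> :: "('s::semiring_0 \<times> 's) set"
    and M :: "('m, 's, 'more) semimodule_scheme"
  assumes \<mu>: "right_congruence \<mu>"
  shows "quotient_semimodule \<mu> \<simeq>\<^sub>S M \<longleftrightarrow> (\<exists>g. linear_cover g M \<and> \<mu> = kernel_congruence g)"
proof
  have e: "equiv UNIV \<mu>" using \<mu> by (simp add: right_congruence_def)
  have class_eq: "\<mu> `` {a} = \<mu> `` {b} \<longleftrightarrow> (a, b) \<in> \<mu>" for a b
    using eq_equiv_class_iff[OF e] by simp
  have carr: "carrier (quotient_semimodule \<mu>) = range (\<lambda>a. \<mu> `` {a})"
    by (auto simp: quotient_semimodule_def quotient_def)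
  have zero: "\<zero>\<^bsub>quotient_semimodule \<mu>\<^esub> = \<mu> `` {0}"
    by (simp add: quotient_semimodule_def)
  {
    assume "quotient_semimodule \<mu> \<simeq>\<^sub>S M"
    then obtain f where f: "f \<in> semimodule_hom (quotient_semimodule \<mu>) M"
      and bij: "bij_betw f (range (\<lambda>a. \<mu> `` {a})) (carrier M)"
      unfolding semimodule_iso_def carr by blast
    define g where "g = (\<lambda>a. f (\<mu> `` {a}))"
    have "range g = carrier M"
      using bij_betw_imp_surj_on[OF bij] by (simp add: g_def image_image)
    then have "linear_cover g M"
      using f by (simp add: linear_cover_def semimodule_hom_def g_def carr zero
          quotient_add[OF \<mu>] quotient_act[OF \<mu>])
    moreover have "g a = g b \<longleftrightarrow> (a, b) \<in> \<mu>" for a b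
      using inj_on_eq_iff[OF bij_betw_imp_inj_on[OF bij], of "\<mu> `` {a}" "\<mu> `` {b}"]
      by (auto simp: g_def class_eq)
    then have "\<mu> = kernel_congruence g"
      by (auto simp: kernel_congruence_def)
    ultimately show "\<exists>g. linear_cover g M \<and> \<mu> = kernel_congruence g" by blast
  next
    assume "\<exists>g. linear_cover g M \<and> \<mu> = kernel_congruence g"
    then obtain g where g: "linear_cover g M" and ker: "\<mu> = kernel_congruence g" by blast
    have fibre: "(a, b) \<in> \<mu> \<longleftrightarrow> g a = g b" for a b
      by (simp add: ker kernel_congruence_def)
    define f where "f = (\<lambda>X. g (SOME x. x \<in> X))"
    have f: "f (\<mu> `` {a}) = g a" for a
    proof -
      have "a \<in> \<mu> `` {a}" by (simp add: fibre)
      then have "(SOME x. x \<in> \<mu> `` {a}) \<in> \<mu> `` {a}" by (rule someI)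
      then show ?thesis by (simp add: f_def fibre)
    qed
    have "f \<in> semimodule_hom (quotient_semimodule \<mu>) M"
      using g by (auto simp: semimodule_hom_def linear_cover_def carr zero f
          quotient_add[OF \<mu>] quotient_act[OF \<mu>])
    moreover have "bij_betw f (carrier (quotient_semimodule \<mu>)) (carrier M)"
      using g by (auto simp: bij_betw_def inj_on_def carr f class_eq fibre linear_cover_def image_image)
    ultimately show "quotient_semimodule \<mu> \<simeq>\<^sub>S M"
      unfolding semimodule_iso_def by blast
  }
qed

lemma saturated_vimage:
  assumes g: "linear_cover g M" and N: "subsemimodule N M"
  shows "saturated_right_ideal (kernel_congruence g) (g -` N)"
  using assms
  by (auto simp: saturated_right_ideal_def right_ideal_def kernel_congruence_def
      linear_cover_def subsemimodule_def)

lemma subsemimodule_image: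
  assumes g: "linear_cover g M" and J: "right_ideal J"
  shows "subsemimodule (g ` J) M"
proof -
  have hom: "g a \<oplus>\<^bsub>M\<^esub> g b = g (a + b)" "g a \<triangleleft>\<^bsub>M\<^esub> s = g (a * s)" "\<zero>\<^bsub>M\<^esub> = g 0" for a b s
    using g by (simp_all add: linear_cover_def)
  have "g ` J \<subseteq> carrier M"
    using g by (auto simp: linear_cover_def)
  then show ?thesis
    using J by (auto simp: subsemimodule_def right_ideal_def hom)
qed

text \<open>Preimage and image along \<open>g\<close> are mutually inverse here: \<open>g\<close> is onto, so every subsemimodule
  is the image of its preimage, and a saturated \<open>J\<close> is a union of fibres of \<open>g\<close>, so it is the
  preimage of its image. Both preserve inclusion, and \<open>[0]\<^sub>\<mu>\<close> is the preimage of \<open>{0}\<close>.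
  Properness of \<open>[0]\<^sub>\<mu>\<close> becomes the condition that \<open>M\<close> is nonzero, which the condition on
  subsemimodules alone does not give.\<close>

lemma maximal_kernel_class_iff:
  assumes g: "linear_cover g M" and M: "right_semimodule M"
  shows "maximal_saturated_right_ideal (kernel_congruence g) (kernel_congruence g `` {0}) \<longleftrightarrow>
    carrier M \<noteq> {\<zero>\<^bsub>M\<^esub>} \<and> (\<forall>N. subsemimodule N M \<longrightarrow> N = {\<zero>\<^bsub>M\<^esub>} \<or> N = carrier M)"
    (is "?max \<longleftrightarrow> ?nonzero \<and> ?simple")
proof -
  interpret right_semimodule M by (rule M)
  have range: "range g = carrier M" and zero: "g 0 = \<zero>\<^bsub>M\<^esub>"
    using g by (simp_all add: linear_cover_def)
  have class0: "kernel_congruence g `` {0} = g -` {\<zero>\<^bsub>M\<^esub>}"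
    by (auto simp: kernel_congruence_def zero)
  have proper: "g -` N \<noteq> UNIV \<longleftrightarrow> N \<noteq> carrier M" if "N \<subseteq> carrier M" for N
    using that unfolding range[symmetric] by auto
  have "subsemimodule {\<zero>\<^bsub>M\<^esub>} M"
    by (simp add: subsemimodule_def act_zero_left)
  then have sat0: "saturated_right_ideal (kernel_congruence g) (g -` {\<zero>\<^bsub>M\<^esub>})"
    by (rule saturated_vimage[OF g])
  show ?thesis
  proof
    assume max: ?max
    have ?nonzero
      using max proper[of "{\<zero>\<^bsub>M\<^esub>}"]
      by (auto simp: maximal_saturated_right_ideal_def class0)
    moreover have ?simple
    proof (intro allI impI)
      fix N assume N: "subsemimodule N M"
      then have sub: "N \<subseteq> carrier M" "\<zero>\<^bsub>M\<^esub> \<in> N" by (simp_all add: subsemimodule_def)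
      then have "g -` {\<zero>\<^bsub>M\<^esub>} \<subseteq> g -` N" by auto
      then have "g -` N = UNIV \<or> g -` N = g -` {\<zero>\<^bsub>M\<^esub>}"
        using max saturated_vimage[OF g N]
        unfolding maximal_saturated_right_ideal_def class0 by blast
      moreover have "g ` (g -` N) = N" "g ` (g -` {\<zero>\<^bsub>M\<^esub>}) = {\<zero>\<^bsub>M\<^esub>}"
        using sub zero range by auto
      ultimately show "N = {\<zero>\<^bsub>M\<^esub>} \<or> N = carrier M"
        using range by metis
    qed
    ultimately show "?nonzero \<and> ?simple" by blast
  next
    assume R: "?nonzero \<and> ?simple"
    have "J = g -` {\<zero>\<^bsub>M\<^esub>}"
      if J: "saturated_right_ideal (kernel_congruence g) J" "J \<noteq> UNIV" "g -` {\<zero>\<^bsub>M\<^esub>} \<subseteq> J" for J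
    proof -
      have "subsemimodule (g ` J) M"
        using J(1) by (intro subsemimodule_image[OF g]) (simp add: saturated_right_ideal_def)
      then have "g ` J = {\<zero>\<^bsub>M\<^esub>} \<or> g ` J = carrier M" using R by blast
      moreover have full: "g -` (g ` J) = J"
        using J(1) by (auto simp: saturated_right_ideal_def kernel_congruence_def)
      then have "g ` J \<noteq> carrier M" using J(2) unfolding range[symmetric] by auto
      ultimately show ?thesis using full by simp
    qed
    moreover have "g -` {\<zero>\<^bsub>M\<^esub>} \<noteq> UNIV"
      using R proper[of "{\<zero>\<^bsub>M\<^esub>}"] by auto
    ultimately show ?max
      using sat0 unfolding maximal_saturated_right_ideal_def class0 by blast
  qed
qed

lemma subsemimodule_orbit:
  assumes M: "right_semimodule M" and m: "m \<in> carrier M"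
  shows "subsemimodule (range (\<lambda>s. m \<triangleleft>\<^bsub>M\<^esub> s)) M"
proof -
  interpret right_semimodule M by (rule M)
  have "\<zero>\<^bsub>M\<^esub> = m \<triangleleft>\<^bsub>M\<^esub> 0" "(m \<triangleleft>\<^bsub>M\<^esub> s) \<oplus>\<^bsub>M\<^esub> (m \<triangleleft>\<^bsub>M\<^esub> t) = m \<triangleleft>\<^bsub>M\<^esub> (s + t)"
    "(m \<triangleleft>\<^bsub>M\<^esub> s) \<triangleleft>\<^bsub>M\<^esub> t = m \<triangleleft>\<^bsub>M\<^esub> (s * t)" for s t
    using m by (simp_all add: act_zero_right act_add_right act_mult)
  then show ?thesis
    using m by (auto simp: subsemimodule_def act_closed)
qed

lemma minimal_cyclic:
  assumes M: "right_semimodule M" and min: "minimal_semimodule M"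
  obtains m where "m \<in> carrier M" "range (\<lambda>s. m \<triangleleft>\<^bsub>M\<^esub> s) = carrier M"
proof -
  obtain m s where m: "m \<in> carrier M" and ms: "m \<triangleleft>\<^bsub>M\<^esub> s \<noteq> \<zero>\<^bsub>M\<^esub>"
    using min by (auto simp: minimal_semimodule_def)
  have "range (\<lambda>s. m \<triangleleft>\<^bsub>M\<^esub> s) \<noteq> {\<zero>\<^bsub>M\<^esub>}" using ms by auto
  then have "range (\<lambda>s. m \<triangleleft>\<^bsub>M\<^esub> s) = carrier M"
    using min subsemimodule_orbit[OF M m] unfolding minimal_semimodule_def by blast
  with m show thesis by (rule that)
qed

theorem theorem3p5:
  fixes M :: "('m, 's::semiring_0) semimodule"
  assumes "right_semimodule M"
  shows "minimal_semimodule M \<longleftrightarrow>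
    (\<exists>\<mu> :: ('s \<times> 's) set.
       regular_right_congruence \<mu> \<and>
       quotient_semimodule \<mu> \<simeq>\<^sub>S M \<and>
       maximal_saturated_right_ideal \<mu> (\<mu> `` {0}))"
proof
  interpret right_semimodule M by (rule assms)
  {
    assume min: "minimal_semimodule M"
    obtain m where m: "m \<in> carrier M" and cyc: "range (\<lambda>s. m \<triangleleft>\<^bsub>M\<^esub> s) = carrier M"
      by (rule minimal_cyclic[OF assms min])
    define g where "g = (\<lambda>s. m \<triangleleft>\<^bsub>M\<^esub> s)"
    have g: "linear_cover g M"
      using m cyc by (simp add: linear_cover_def g_def act_zero_right act_add_right act_mult)
    obtain e where e: "m \<triangleleft>\<^bsub>M\<^esub> e = m"
      using m cyc by (metis imageE)
    have "(e * s, s) \<in> kernel_congruence g" for s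
      using m by (simp add: kernel_congruence_def g_def act_mult e)
    then have "regular_right_congruence (kernel_congruence g)"
      using right_congruence_kernel[OF g] by (auto simp: regular_right_congruence_def)
    moreover have "quotient_semimodule (kernel_congruence g) \<simeq>\<^sub>S M"
      using g quotient_iso_iff_cover[OF right_congruence_kernel[OF g]] by blast
    moreover have "carrier M \<noteq> {\<zero>\<^bsub>M\<^esub>}"
      using min by (auto simp: minimal_semimodule_def act_zero_left)
    then have "maximal_saturated_right_ideal (kernel_congruence g) (kernel_congruence g `` {0})"
      using min maximal_kernel_class_iff[OF g assms] by (simp add: minimal_semimodule_def)
    ultimately show "\<exists>\<mu> :: ('s \<times> 's) set.
       regular_right_congruence \<mu> \<and>
       quotient_semimodule \<mu> \<simeq>\<^sub>S M \<and>
       maximal_saturated_right_ideal \<mu> (\<mu> `` {0})" by blast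
  next
    assume "\<exists>\<mu> :: ('s \<times> 's) set.
       regular_right_congruence \<mu> \<and>
       quotient_semimodule \<mu> \<simeq>\<^sub>S M \<and>
       maximal_saturated_right_ideal \<mu> (\<mu> `` {0})"
    then obtain \<mu> :: "('s \<times> 's) set" where reg: "regular_right_congruence \<mu>"
      and iso: "quotient_semimodule \<mu> \<simeq>\<^sub>S M"
      and max: "maximal_saturated_right_ideal \<mu> (\<mu> `` {0})" by blast
    obtain g where g: "linear_cover g M" and \<mu>: "\<mu> = kernel_congruence g"
      using reg iso quotient_iso_iff_cover[of \<mu> M] by (auto simp: regular_right_congruence_def)
    obtain e where e: "(e * s, s) \<in> \<mu>" for s
      using reg by (auto simp: regular_right_congruence_def)
    have nonzero: "carrier M \<noteq> {\<zero>\<^bsub>M\<^esub>}"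
      and simple: "\<forall>N. subsemimodule N M \<longrightarrow> N = {\<zero>\<^bsub>M\<^esub>} \<or> N = carrier M"
      using max maximal_kernel_class_iff[OF g assms] by (simp_all add: \<mu>)
    have range: "range g = carrier M" using g by (simp add: linear_cover_def)
    obtain s where s: "g s \<noteq> \<zero>\<^bsub>M\<^esub>"
      using nonzero zero_closed unfolding range[symmetric] by blast
    have "g e \<triangleleft>\<^bsub>M\<^esub> s = g s"
      using e[of s] g by (simp add: \<mu> kernel_congruence_def linear_cover_def)
    moreover have "g e \<in> carrier M" using range by auto
    ultimately show "minimal_semimodule M"
      using s simple unfolding minimal_semimodule_def by metis
  }
qed

end
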